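(* Let $A\subseteq B$ be a ring extension, and let $\mathcal{G}_1\subseteq\mathcal{G}_2$ be two subsets of $\mathbf{F}_A(B)$. (a) If $\star\in\mathrm{Mult}(A,B,\mathcal{G}_2)$ restricts to a map $\star':\mathcal{G}_1\to\mathcal{G}_1$, then $\star'\in\mathrm{Mult}(A,B,\mathcal{G}_1)$. (b) If $\mathcal{G}_1$ is an interval in $\mathbf{F}_A(B)$ and $\mathcal{G}_1$ and $\mathcal{G}_2$ have a common maximum, then every multiplicative operation on $(A,B,\mathcal{G}_2)$ can be restricted to $\mathcal{G}_1$, and the map $\rho:\mathrm{Mult}(A,B,\mathcal{G}_2)\to\mathrm{Mult}(A,B,\mathcal{G}_1)$, $\star\mapsto\star|_{\mathcal{G}_1}$, is well-defined and order-preserving.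
   Context: All rings are commutative with unit. For a ring extension $A\subseteq B$, $\mathbf{F}_A(B)$ is the set of $A$-submodules of $B$, ordered by inclusion; for $I\in\mathbf{F}_A(B)$ and $b\in B$, $(I:b):=\{x\in B\mid bx\in I\}$. A closure operation on a partially ordered set is an extensive, order-preserving, idempotent self-map. For $\mathcal{G}\subseteq\mathbf{F}_A(B)$, a multiplicative operation on $(A,B,\mathcal{G})$ is a closure operation $\star:\mathcal{G}\to\mathcal{G}$, $I\mapsto I^\star$, such that $(I:b)^\star\subseteq(I^\star:b)$ for all $I\in\mathcal{G}$, $b\in B$ with $(I:b)\in\mathcal{G}$. $\mathrm{Mult}(A,B,\mathcal{G})$ is the set of these, ordered by $\star_1\leq\star_2$ iff $I^{\star_1}\subseteq I^{\star_2}$ for all $I\in\mathcal{G}$. $\mathcal{G}$ is an interval if whenever $X\subseteq Y$ are in $\mathcal{G}$ and $Z\in\mathbf{F}_A(B)$ satisfies $X\subseteq Z\subseteq Y$, then $Z\in\mathcal{G}$. *)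

theory Defs
  imports "HOL-Algebra.Module" "HOL-Algebra.Subrings"
begin

text \<open>Throughout, \<open>B\<close> is a ring record and \<open>A \<subseteq> carrier B\<close> the carrier of a subring.\<close>

text \<open>The type of module records does not mention the scalar ring, so the record below
  describes \<open>B\<close> as a module over any of its subrings; the scalars enter only through the
  ring argument of \<^const>\<open>submodule\<close>.\<close>

definition regular_module :: "('b, 'm) ring_scheme \<Rightarrow> ('b, 'b) module"
  where "regular_module B =
    \<lparr>carrier = carrier B, monoid.mult = monoid.mult B, one = one B, ring.zero = ring.zero B,
     ring.add = ring.add B, smult = monoid.mult B\<rparr>"

definition submods :: "'b set \<Rightarrow> ('b, 'm) ring_scheme \<Rightarrow> 'b set set"
  where "submods A B = {I. submodule I (B\<lparr>carrier := A\<rparr>) (regular_module B)}"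

definition colon :: "('b, 'm) ring_scheme \<Rightarrow> 'b set \<Rightarrow> 'b \<Rightarrow> 'b set"
  where "colon B I b = {x \<in> carrier B. b \<otimes>\<^bsub>B\<^esub> x \<in> I}"

text \<open>Self-maps of \<open>P\<close> are taken in the extensional function space \<open>P \<rightarrow>\<^sub>E P\<close>
  (value \<^const>\<open>undefined\<close> outside \<open>P\<close>), so that two of them are equal iff they agree on \<open>P\<close>.\<close>

definition closure_operation :: "'p::order set \<Rightarrow> ('p \<Rightarrow> 'p) \<Rightarrow> bool"
  where "closure_operation P c \<longleftrightarrow>
    c \<in> P \<rightarrow>\<^sub>E P \<and> (\<forall>x\<in>P. x \<le> c x) \<and> mono_on P c \<and> (\<forall>x\<in>P. c (c x) = c x)"

text \<open>\<open>A\<close> occurs in the multiplicative-operation condition only through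
  \<open>\<G> \<subseteq> submods A B\<close>, which is a hypothesis wherever \<open>Mult\<close> is used; hence it is not an argument here.\<close>

definition Mult :: "('b, 'm) ring_scheme \<Rightarrow> 'b set set \<Rightarrow> ('b set \<Rightarrow> 'b set) set"
  where "Mult B \<G> = {star. closure_operation \<G> star \<and>
    (\<forall>I\<in>\<G>. \<forall>b\<in>carrier B. colon B I b \<in> \<G> \<longrightarrow> star (colon B I b) \<subseteq> colon B (star I) b)}"

definition Mult_le :: "'b set set \<Rightarrow> ('b set \<Rightarrow> 'b set) \<Rightarrow> ('b set \<Rightarrow> 'b set) \<Rightarrow> bool"
  where "Mult_le \<G> star1 star2 \<longleftrightarrow> (\<forall>I\<in>\<G>. star1 I \<subseteq> star2 I)"

definition submods_interval :: "'b set \<Rightarrow> ('b, 'm) ring_scheme \<Rightarrow> 'b set set \<Rightarrow> bool"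
  where "submods_interval A B \<G> \<longleftrightarrow>
    (\<forall>I\<in>\<G>. \<forall>J\<in>\<G>. \<forall>K\<in>submods A B. I \<subseteq> K \<and> K \<subseteq> J \<longrightarrow> K \<in> \<G>)"

definition is_maximum :: "'p::order set \<Rightarrow> 'p \<Rightarrow> bool"
  where "is_maximum P m \<longleftrightarrow> m \<in> P \<and> (\<forall>x\<in>P. x \<le> m)"

end

theory Submission
  imports Defs
begin

text \<open>Every clause in the definition of a multiplicative operation quantifies over members of
  the family, so it survives passage to a smaller family as soon as the operation maps that
  family to itself; the colon condition loses nothing, because it is imposed only where the colon
  lies in the family. For an interval \<open>\<G>\<^sub>1\<close> sharing a maximum \<open>M\<close> with \<open>\<G>\<^sub>2\<close>, stability is
  automatic: the closure of \<open>I \<in> \<G>\<^sub>1\<close> is a submodule lying between \<open>I\<close> and \<open>M\<close>, both of which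
  are in \<open>\<G>\<^sub>1\<close>.\<close>

lemma closure_operation_restrict:
  assumes "closure_operation P c" and "Q \<subseteq> P" and "c ` Q \<subseteq> Q"
  shows "closure_operation Q (restrict c Q)"
proof -
  have c: "mono_on P c" "\<And>x. x \<in> P \<Longrightarrow> x \<le> c x" "\<And>x. x \<in> P \<Longrightarrow> c (c x) = c x"
    using assms(1) by (simp_all add: closure_operation_def)
  have stable: "c x \<in> Q" if "x \<in> Q" for x
    using that assms(3) by blast
  have "mono_on Q c"
    using c(1) assms(2) by (rule mono_on_subset)
  then have "mono_on Q (restrict c Q)"
    by (simp add: monotone_on_def)
  moreover have "x \<le> c x" and "c (c x) = c x" if "x \<in> Q" for x
    using that assms(2) c by blast+
  ultimately show ?thesis
    using stable by (simp add: closure_operation_def)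
qed

text \<open>For \<open>I\<close> and its colon in \<open>\<G>\<^sub>1\<close>, the colon condition over \<open>\<G>\<^sub>1\<close> is literally an instance of
  the one over \<open>\<G>\<^sub>2\<close>.\<close>

lemma Mult_restrict:
  assumes "star \<in> Mult B \<G>\<^sub>2" and "\<G>\<^sub>1 \<subseteq> \<G>\<^sub>2" and "star ` \<G>\<^sub>1 \<subseteq> \<G>\<^sub>1"
  shows "restrict star \<G>\<^sub>1 \<in> Mult B \<G>\<^sub>1"
proof -
  have "closure_operation \<G>\<^sub>1 (restrict star \<G>\<^sub>1)"
    using assms by (intro closure_operation_restrict) (simp_all add: Mult_def)
  moreover have "star (colon B I b) \<subseteq> colon B (star I) b"
    if "I \<in> \<G>\<^sub>1" "b \<in> carrier B" "colon B I b \<in> \<G>\<^sub>1" for I b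
    using that assms(1,2) by (simp add: Mult_def subset_iff)
  ultimately show ?thesis
    by (simp add: Mult_def)
qed

text \<open>Extensivity bounds \<open>star I\<close> below by \<open>I\<close>, and being the maximum of \<open>\<G>\<^sub>2\<close> makes \<open>M\<close> an upper
  bound. That \<open>M\<close> is also in \<open>\<G>\<^sub>1\<close> puts both ends inside the interval.\<close>

lemma closure_operation_preserves_interval:
  assumes "closure_operation \<G>\<^sub>2 star"
    and "\<G>\<^sub>1 \<subseteq> \<G>\<^sub>2" and "\<G>\<^sub>2 \<subseteq> submods A B" and "submods_interval A B \<G>\<^sub>1"
    and "is_maximum \<G>\<^sub>1 M" and "is_maximum \<G>\<^sub>2 M"
  shows "star ` \<G>\<^sub>1 \<subseteq> \<G>\<^sub>1"
proof (rule image_subsetI)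
  fix I assume I: "I \<in> \<G>\<^sub>1"
  have "I \<subseteq> star I" and "star I \<in> \<G>\<^sub>2"
    using I assms(1,2) by (auto simp add: closure_operation_def dest: PiE_mem)
  moreover from this have "star I \<subseteq> M" and "star I \<in> submods A B"
    using assms(3,6) by (auto simp: is_maximum_def)
  moreover have "M \<in> \<G>\<^sub>1"
    using assms(5) by (simp add: is_maximum_def)
  ultimately show "star I \<in> \<G>\<^sub>1"
    using I assms(4) unfolding submods_interval_def by blast
qed

theorem proposition4p1:
  fixes B :: "('b, 'm) ring_scheme" and A :: "'b set" and \<G>\<^sub>1 \<G>\<^sub>2 :: "'b set set"
  assumes "cring B" and "subcring A B"
    and "\<G>\<^sub>1 \<subseteq> \<G>\<^sub>2" and "\<G>\<^sub>2 \<subseteq> submods A B"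
  shows "(\<forall>star \<in> Mult B \<G>\<^sub>2. star ` \<G>\<^sub>1 \<subseteq> \<G>\<^sub>1 \<longrightarrow> restrict star \<G>\<^sub>1 \<in> Mult B \<G>\<^sub>1)
    \<and> (submods_interval A B \<G>\<^sub>1 \<and> (\<exists>M. is_maximum \<G>\<^sub>1 M \<and> is_maximum \<G>\<^sub>2 M) \<longrightarrow>
        (\<forall>star \<in> Mult B \<G>\<^sub>2. star ` \<G>\<^sub>1 \<subseteq> \<G>\<^sub>1)
        \<and> (\<lambda>star. restrict star \<G>\<^sub>1) \<in> Mult B \<G>\<^sub>2 \<rightarrow> Mult B \<G>\<^sub>1
        \<and> monotone_on (Mult B \<G>\<^sub>2) (Mult_le \<G>\<^sub>2) (Mult_le \<G>\<^sub>1) (\<lambda>star. restrict star \<G>\<^sub>1))"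
proof (intro conjI impI)
  show "\<forall>star \<in> Mult B \<G>\<^sub>2. star ` \<G>\<^sub>1 \<subseteq> \<G>\<^sub>1 \<longrightarrow> restrict star \<G>\<^sub>1 \<in> Mult B \<G>\<^sub>1"
    using Mult_restrict assms(3) by blast
next
  assume hyp: "submods_interval A B \<G>\<^sub>1 \<and> (\<exists>M. is_maximum \<G>\<^sub>1 M \<and> is_maximum \<G>\<^sub>2 M)"
  show stable: "\<forall>star \<in> Mult B \<G>\<^sub>2. star ` \<G>\<^sub>1 \<subseteq> \<G>\<^sub>1"
    using hyp closure_operation_preserves_interval[OF _ assms(3,4)]
    by (force simp: Mult_def)
  show "(\<lambda>star. restrict star \<G>\<^sub>1) \<in> Mult B \<G>\<^sub>2 \<rightarrow> Mult B \<G>\<^sub>1"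
    using stable by (intro Pi_I Mult_restrict[OF _ assms(3)]) simp_all
  show "monotone_on (Mult B \<G>\<^sub>2) (Mult_le \<G>\<^sub>2) (Mult_le \<G>\<^sub>1) (\<lambda>star. restrict star \<G>\<^sub>1)"
    using subsetD[OF assms(3)] by (simp add: monotone_on_def Mult_le_def)
qed

end
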